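(* Let $n,k,\gamma$ be positive integers with $\gamma+1\le k<3\lceil\gamma/2\rceil$ and $n\ge2k+\gamma$. Then $$B_2(n,k,k+\gamma;3)\ge 2^{2\left\lfloor\frac{n-2k+1}{k+1}\right\rfloor}.$$
   Context: For a prime power $q$, $\mathcal{G}_q(n,k)$ denotes the set of all $k$-dimensional subspaces of $\mathbb{F}_q^n$. An $\alpha$-$(n,k,\delta)_q^c$ covering Grassmannian code is a subset $\mathcal{C}\subseteq\mathcal{G}_q(n,k)$ (no repeated codewords) such that every set of $\alpha$ distinct codewords of $\mathcal{C}$ spans a subspace of $\mathbb{F}_q^n$ of dimension at least $k+\delta$. $B_q(n,k,\delta;\alpha)$ denotes the maximum size of an $\alpha$-$(n,k,\delta)_q^c$ code. *)

theory Defs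
  imports Complex_Main "HOL-Library.Z2" "HOL-Library.Function_Algebras"
begin

text \<open>The field F_2 is the type bit. The space F_2^n is modelled as the set of
  vectors v :: nat => bit with v i = 0 for all i >= n (coordinates 0..n-1),
  a subspace of the F_2-vector space nat => bit with pointwise operations.\<close>

definition bscale :: "bit \<Rightarrow> (nat \<Rightarrow> bit) \<Rightarrow> nat \<Rightarrow> bit" where
  "bscale c v = (\<lambda>i. c * v i)"

lemma vector_space_bscale: "vector_space bscale"
  unfolding vector_space_def module_def by (auto simp: bscale_def fun_eq_iff algebra_simps)

definition F2n :: "nat \<Rightarrow> (nat \<Rightarrow> bit) set" where
  "F2n n = {v. \<forall>i\<ge>n. v i = 0}"

definition span2 :: "(nat \<Rightarrow> bit) set \<Rightarrow> (nat \<Rightarrow> bit) set" where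
  "span2 = module.span bscale"

definition dim2 :: "(nat \<Rightarrow> bit) set \<Rightarrow> nat" where
  "dim2 = vector_space.dim bscale"

definition subspace2 :: "(nat \<Rightarrow> bit) set \<Rightarrow> bool" where
  "subspace2 = module.subspace bscale"

definition Grass2 :: "nat \<Rightarrow> nat \<Rightarrow> (nat \<Rightarrow> bit) set set" where
  "Grass2 n k = {V. subspace2 V \<and> V \<subseteq> F2n n \<and> dim2 V = k}"

definition covering_code2 :: "nat \<Rightarrow> nat \<Rightarrow> nat \<Rightarrow> nat \<Rightarrow> (nat \<Rightarrow> bit) set set \<Rightarrow> bool" where
  "covering_code2 n k \<delta> \<alpha> C \<longleftrightarrow> C \<subseteq> Grass2 n k \<and>
     (\<forall>S \<subseteq> C. card S = \<alpha> \<longrightarrow> dim2 (span2 (\<Union>S)) \<ge> k + \<delta>)"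

definition B2 :: "nat \<Rightarrow> nat \<Rightarrow> nat \<Rightarrow> nat \<Rightarrow> nat" where
  "B2 n k \<delta> \<alpha> = Max {card C | C. covering_code2 n k \<delta> \<alpha> C}"

end

theory Submission
  imports Defs "HOL-Algebra.Algebraic_Closure_Type"
begin

text \<open>
  The hypotheses force \<open>k = 2\<close>, \<open>\<gamma> = 1\<close> or \<open>k \<ge> 4\<close>. Put \<open>m = (n - 2k + 1) div (k + 1)\<close>.

  For \<open>k \<ge> 4\<close> let \<open>K\<close> be the field with \<open>2\<^sup>k\<close> elements and \<open>s = \<lceil>m / 2\<rceil>\<close>. To \<open>x \<in> K\<^sup>s\<close> assign the
  \<open>K\<close>-line through \<open>(1, x\<^sub>0, x\<^sub>0\<^sup>2, \<dots>)\<close> in \<open>K\<^bsup>2s+1\<^esup>\<close>, a binary space of dimension \<open>k(2s + 1) \<le> n\<close>.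
  A Vandermonde argument shows that three distinct such lines are independent over \<open>K\<close>, so they
  span \<open>3k > 2k + \<gamma>\<close> binary dimensions, and there are \<open>2\<^bsup>ks\<^esup> \<ge> 2\<^bsup>2m\<^esup>\<close> of them.

  For \<open>k = 2\<close> read vectors as binary polynomials and take the planes \<open>\<langle>g, Xg\<rangle>\<close> with \<open>g = 1 + X\<^sup>2p\<close>,
  \<open>deg p < 2m\<close>. The differences of three values of \<open>p\<close> span a two-dimensional space \<open>U\<close>, and
  \<open>U + XU\<close> has dimension at least 3, because multiplication by \<open>X\<close> raises the top degree; together
  with one plane this gives 5 dimensions.

  Since all spaces are finite, dimensions are determined by \<open>|V| = 2\<^bsup>dim V\<^esup>\<close>.
\<close>

section \<open>Binary vector spaces\<close>

text \<open>The only scalars are 0 and 1, so adjoining an independent \<open>b\<close> adds just the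
  coset \<open>span B + b\<close>, disjoint from \<open>span B\<close>: the size doubles.\<close>

lemma card_span_bit:
  fixes scale :: "bit \<Rightarrow> 'a::ab_group_add \<Rightarrow> 'a"
  assumes "vector_space scale" "finite B" "\<not> module.dependent scale B"
  shows "finite (module.span scale B) \<and> card (module.span scale B) = 2 ^ card B"
proof -
  interpret vector_space scale by fact
  show ?thesis using assms(2,3)
  proof (induction B rule: finite_induct)
    case empty
    then show ?case by simp
  next
    case (insert b B)
    have b: "b \<notin> span B" and B: "independent B"
      using insert.prems insert.hyps by (auto simp: independent_insert)
    have IH: "finite (span B)" "card (span B) = 2 ^ card B"
      using insert.IH[OF B] by auto
    have bit_cases: "(\<exists>k. P k) \<longleftrightarrow> P 0 \<or> P 1" for P :: "bit \<Rightarrow> bool"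
      by (metis bit_not_one_iff)
    have "span (insert b B) = {x. x \<in> span B \<or> x - b \<in> span B}"
      by (simp add: span_insert bit_cases)
    also have "\<dots> = span B \<union> (\<lambda>x. x + b) ` span B"
      by (auto simp: image_iff) (metis diff_add_cancel)
    finally have eq: "span (insert b B) = span B \<union> (\<lambda>x. x + b) ` span B" .
    have disj: "span B \<inter> (\<lambda>x. x + b) ` span B = {}"
      using b by (auto simp: span_add_eq)
    have "card ((\<lambda>x. x + b) ` span B) = card (span B)"
      by (rule card_image) (auto simp: inj_on_def)
    then show ?case
      using IH insert.hyps disj by (simp add: eq card_Un_disjoint)
  qed
qed

text \<open>Generic in \<open>scale\<close> because it serves both \<open>bscale\<close> and the
  algebraic closure of F_2 viewed as a binary space.\<close>

lemma card_subspace_bit: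
  fixes scale :: "bit \<Rightarrow> 'a::ab_group_add \<Rightarrow> 'a"
  assumes "vector_space scale" "finite V" "module.subspace scale V"
  shows "card V = 2 ^ vector_space.dim scale V"
proof -
  interpret vector_space scale by fact
  obtain B where B: "B \<subseteq> V" "independent B" "V \<subseteq> span B" "card B = dim V"
    by (rule basis_exists)
  have "span B = V"
    using B assms(3) by (metis span_minimal subset_antisym)
  then show ?thesis
    using card_span_bit[OF assms(1) _ B(2)] B(1,4) assms(2) finite_subset by metis
qed

interpretation F2: vector_space bscale
  by (rule vector_space_bscale)

lemma subspace2_iff:
  "subspace2 V \<longleftrightarrow> 0 \<in> V \<and> (\<forall>x\<in>V. \<forall>y\<in>V. x + y \<in> V)"
proof -
  have "bscale c x = (if c = 0 then 0 else x)" for c x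
    by (cases c) (auto simp: bscale_def fun_eq_iff)
  then show ?thesis
    by (auto simp: subspace2_def F2.subspace_def)
qed

lemma card_F2n: "finite (F2n n)" "card (F2n n) = 2 ^ n"
proof -
  have "bij_betw (\<lambda>A i. if i \<in> A then 1 else 0) (Pow {..<n}) (F2n n)"
    by (rule bij_betwI[where g = "\<lambda>v. {i. v i = 1}"])
      (auto simp: F2n_def fun_eq_iff Pi_iff not_less[symmetric])
  then show "finite (F2n n)" "card (F2n n) = 2 ^ n"
    by (simp_all flip: bij_betw_finite bij_betw_same_card add: card_Pow)
qed

lemma subspace2_F2n: "subspace2 (F2n n)"
  by (auto simp: subspace2_iff F2n_def)

lemma card_eq_dim2:
  assumes "subspace2 V" "V \<subseteq> F2n n"
  shows "card V = 2 ^ dim2 V"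
  using card_subspace_bit[OF vector_space_bscale, of V] assms card_F2n(1) finite_subset
  unfolding subspace2_def dim2_def by blast

lemma Grass2I:
  assumes "subspace2 V" "V \<subseteq> F2n n" "card V = 2 ^ k"
  shows "V \<in> Grass2 n k"
  using card_eq_dim2[OF assms(1,2)] assms by (simp add: Grass2_def)

text \<open>Both codes get their spanning bound from this count, with \<open>D\<close> the injective
  image of a set of coefficient tuples.\<close>

lemma dim2_span_ge:
  assumes "A \<subseteq> F2n n" "D \<subseteq> span2 A" "2 ^ d \<le> card D"
  shows "d \<le> dim2 (span2 A)"
proof -
  have sub: "subspace2 (span2 A)"
    by (simp add: subspace2_def span2_def)
  have le: "span2 A \<subseteq> F2n n"
    using assms(1) subspace2_F2n by (simp add: subspace2_def span2_def F2.span_minimal)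
  have "card D \<le> card (span2 A)"
    using assms(2) le card_F2n(1) by (meson card_mono finite_subset)
  then have "(2::nat) ^ d \<le> 2 ^ dim2 (span2 A)"
    using assms(3) card_eq_dim2[OF sub le] by linarith
  then show ?thesis
    by (rule power_le_imp_le_exp[rotated]) simp
qed

lemma covering_code2_mono:
  assumes "covering_code2 n k \<delta> \<alpha> C" "\<delta>' \<le> \<delta>"
  shows "covering_code2 n k \<delta>' \<alpha> C"
proof -
  have "k + \<delta>' \<le> dim2 (span2 (\<Union>S))" if "S \<subseteq> C" "card S = \<alpha>" for S
    using assms that unfolding covering_code2_def by (metis add_left_mono le_trans)
  then show ?thesis
    using assms(1) by (simp add: covering_code2_def)
qed

text \<open>\<open>Max\<close> bounds its members only on a finite set; here codes are families of
  subsets of the finite \<open>F2n n\<close>.\<close>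

lemma B2_ge:
  assumes "covering_code2 n k \<delta> \<alpha> C" "N \<le> card C"
  shows "N \<le> B2 n k \<delta> \<alpha>"
proof -
  have "{C. covering_code2 n k \<delta> \<alpha> C} \<subseteq> Pow (Pow (F2n n))"
    by (auto simp: covering_code2_def Grass2_def)
  then have "finite {C. covering_code2 n k \<delta> \<alpha> C}"
    by (meson card_F2n(1) finite_Pow_iff finite_subset)
  then have "finite {card C | C. covering_code2 n k \<delta> \<alpha> C}"
    by simp
  then have "card C \<le> B2 n k \<delta> \<alpha>"
    unfolding B2_def using assms(1) by (intro Max_ge) auto
  then show ?thesis
    using assms(2) by simp
qed

lemma card_3_obtain_index:
  assumes "S \<subseteq> c ` I" "card S = 3"
  obtains x y z where "x \<in> I" "y \<in> I" "z \<in> I" "x \<noteq> y" "x \<noteq> z" "y \<noteq> z"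
    "S = {c x, c y, c z}"
proof -
  obtain u v w where S: "S = {u, v, w}" "u \<noteq> v" "u \<noteq> w" "v \<noteq> w"
    using assms(2) by (auto simp: card_3_iff)
  then have "u \<in> c ` I" "v \<in> c ` I" "w \<in> c ` I"
    using assms(1) by auto
  then obtain x y z where "x \<in> I" "u = c x" "y \<in> I" "v = c y" "z \<in> I" "w = c z"
    by (auto elim!: imageE)
  with S show thesis
    by (intro that[of x y z]) auto
qed

section \<open>The field with \<open>2\<^sup>k\<close> elements\<close>

lemma bit_ac_add_self: "x + x = (0 :: bit alg_closure)"
proof -
  have "to_ac (1 + 1 :: bit) = 0" by simp
  then have "1 + 1 = (0 :: bit alg_closure)" by (simp only: to_ac_add to_ac_1)
  then show ?thesis by (metis distrib_left mult.right_neutral mult_zero_right)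
qed

text \<open>The fixed points of the \<open>k\<close>-th iterate of Frobenius; for positive
  \<open>k\<close> this is the field with 2^k elements.\<close>

definition GF2 :: "nat \<Rightarrow> bit alg_closure set" where
  "GF2 k = {x. x ^ (2 ^ k) = x}"

lemma bit_ac_power_add: "(x + y) ^ (2 ^ k) = x ^ (2 ^ k) + (y :: bit alg_closure) ^ (2 ^ k)"
proof (induction k arbitrary: x y)
  case (Suc k)
  have "(x + y) ^ 2 = x ^ 2 + y ^ 2"
    using bit_ac_add_self[of "x * y"] by (simp add: power2_eq_square algebra_simps)
  then show ?case
    using Suc[of "x ^ 2" "y ^ 2"] by (simp add: power_mult)
qed simp

lemma GF2_closed:
  shows "0 \<in> GF2 k" "1 \<in> GF2 k"
    and "x \<in> GF2 k \<Longrightarrow> y \<in> GF2 k \<Longrightarrow> x + y \<in> GF2 k"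
    and "x \<in> GF2 k \<Longrightarrow> y \<in> GF2 k \<Longrightarrow> x * y \<in> GF2 k"
  by (auto simp: GF2_def bit_ac_power_add power_mult_distrib)

text \<open>X^(2^k) - X splits in the closure and has derivative -1, hence only simple roots, as
  many as its degree.\<close>

lemma card_GF2:
  assumes "0 < k"
  shows "finite (GF2 k)" "card (GF2 k) = 2 ^ k"
proof -
  define p :: "bit alg_closure poly" where "p = monom 1 (2 ^ k) - [:0, 1:]"
  have k: "(2::nat) \<le> 2 ^ k"
    using assms by (cases k) auto
  have deg: "degree p = 2 ^ k"
    unfolding p_def using k by (subst diff_conv_add_uminus, subst degree_add_eq_left) (auto simp: degree_monom_eq)
  have roots: "GF2 k = {x. poly p x = 0}"
    by (auto simp: GF2_def p_def poly_monom)
  have "of_nat (2 ^ k) = (0 :: bit alg_closure)"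
    using assms bit_ac_add_self[of 1] by (simp add: zero_power)
  then have der: "pderiv p = - 1"
    unfolding p_def by (simp only: pderiv_diff pderiv_monom) (simp add: pderiv_pCons one_pCons)
  obtain R where R: "size R = degree p"
    "p = smult (lead_coeff p) (\<Prod>x\<in>#R. [:-x, 1:])"
    using alg_closed_imp_factorization[of p] deg by force
  have nz: "p \<noteq> 0" using deg by auto
  have set: "{x. poly p x = 0} = set_mset R"
    using nz by (subst R(2)) (auto simp: poly_prod_mset prod_mset_zero_iff)
  have "count R a \<le> 1" for a
  proof (rule ccontr)
    assume "\<not> count R a \<le> 1"
    then have "a \<in># R" "a \<in># R - {#a#}"
      by (auto simp: in_diff_count simp flip: count_greater_zero_iff)
    then obtain R' where "R = add_mset a (add_mset a R')"
      by (metis insert_DiffM)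
    then have "p = [:-a, 1:] * ([:-a, 1:] * smult (lead_coeff p) (\<Prod>x\<in>#R'. [:-x, 1:]))"
      using R(2) by (metis image_mset_add_mset mult_smult_right prod_mset.add_mset)
    then obtain q where "p = [:-a, 1:] * ([:-a, 1:] * q)" by blast
    then have "poly (pderiv p) a = 0"
      by (simp add: pderiv_mult del: mult_pCons_left)
    then show False using der by simp
  qed
  then have "count R a = 1" if "a \<in># R" for a
    using that by (metis One_nat_def Suc_leI count_greater_zero_iff le_antisym)
  then have "card (set_mset R) = size R"
    by (simp add: size_multiset_overloaded_eq)
  then show "finite (GF2 k)" "card (GF2 k) = 2 ^ k"
    using roots set R(1) deg by auto
qed

text \<open>Counting gives both spaces dimension \<open>k\<close>, so a bijection of bases extends
  linearly. Additivity holds on the whole closure, injectivity is claimed on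
  \<open>GF2 k\<close>.\<close>

lemma GF2_isomorphism:
  assumes "0 < k"
  obtains \<phi> :: "bit alg_closure \<Rightarrow> nat \<Rightarrow> bit"
  where "\<And>x y. \<phi> (x + y) = \<phi> x + \<phi> y" "\<phi> ` GF2 k = F2n k" "inj_on \<phi> (GF2 k)"
proof -
  define sc :: "bit \<Rightarrow> bit alg_closure \<Rightarrow> bit alg_closure" where "sc c x = to_ac c * x" for c x
  have vs: "vector_space sc"
    by unfold_locales (simp_all only: sc_def to_ac_add to_ac_mult to_ac_1 distrib_left distrib_right mult.assoc mult_1_left)
  interpret L: vector_space sc by (fact vs)
  interpret vector_space_pair sc bscale ..
  have "sc c x = (if c = 0 then 0 else x)" for c x
    by (cases c) (auto simp: sc_def)
  then have S: "L.subspace (GF2 k)"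
    using GF2_closed by (auto simp: L.subspace_def)
  have T: "F2.subspace (F2n k)"
    using subspace2_F2n by (simp add: subspace2_def)
  have dims: "L.dim (GF2 k) = k" "F2.dim (F2n k) = k"
    using card_subspace_bit[OF vs card_GF2(1)[OF assms] S] card_GF2(2)[OF assms]
      card_subspace_bit[OF vector_space_bscale card_F2n(1) T] card_F2n(2)[of k] by simp_all
  obtain B where B: "B \<subseteq> GF2 k" "L.independent B" "GF2 k \<subseteq> L.span B" "card B = L.dim (GF2 k)"
    by (rule L.basis_exists)
  obtain C where C: "C \<subseteq> F2n k" "F2.independent C" "F2n k \<subseteq> F2.span C" "card C = F2.dim (F2n k)"
    by (rule F2.basis_exists)
  have "finite B" "finite C"
    using B(1) C(1) card_GF2(1)[OF assms] card_F2n(1) finite_subset by blast+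
  then obtain f where "Vector_Spaces.linear sc bscale f" "f ` GF2 k = F2n k" "inj_on f (GF2 k)"
    using finite_basis_to_basis_subspace_isomorphism[OF S T _ _ B _ C] dims by auto
  then show thesis
    using that linear_add by blast
qed

section \<open>Codes from moment words\<close>

text \<open>Coordinate \<open>k * t + i\<close> holds bit \<open>i\<close> of block
  \<open>t\<close>; from bit \<open>k\<close> on both images vanish, as they lie in
  \<open>F2n k\<close>.\<close>

lemma blockwise_inj:
  fixes g h :: "nat \<Rightarrow> 'a" and \<phi> :: "'a \<Rightarrow> nat \<Rightarrow> bit"
  assumes "\<phi> ` K = F2n k" "inj_on \<phi> K"
    and "\<And>t. t < r \<Longrightarrow> g t \<in> K" "\<And>t. t < r \<Longrightarrow> h t \<in> K"
    and eq: "\<And>j. j < k * r \<Longrightarrow> \<phi> (g (j div k)) (j mod k) = \<phi> (h (j div k)) (j mod k)"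
    and t: "t < r"
  shows "g t = h t"
proof -
  have "\<phi> (g t) i = \<phi> (h t) i" for i
  proof (cases "i < k")
    case True
    have "k * t + i < k * Suc t" using True by simp
    also have "\<dots> \<le> k * r" using t by (intro mult_le_mono2) simp
    finally show ?thesis using eq[of "k * t + i"] True by simp
  next
    case False
    have "\<phi> (g t) \<in> F2n k" "\<phi> (h t) \<in> F2n k"
      using assms(1,3,4) t by auto
    then show ?thesis using False by (simp add: F2n_def)
  qed
  then show ?thesis
    using assms(2-4) t by (auto simp: inj_on_def fun_eq_iff)
qed

text \<open>A coordinate separating \<open>x\<close> from both other words allows Vandermonde
  elimination. Otherwise \<open>x\<close> and \<open>z\<close> agree at \<open>i\<close>, where the
  linear relation kills \<open>b\<close>; coordinate \<open>j\<close> then kills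
  \<open>a\<close>.\<close>

lemma quadratic_relation_coeff_zero:
  fixes x y z :: "nat \<Rightarrow> 'a::field"
  assumes sum: "a + b + c = 0"
    and lin: "\<And>i. i < s \<Longrightarrow> a * x i + b * y i + c * z i = 0"
    and quad: "\<And>i. i < s \<Longrightarrow> a * (x i)\<^sup>2 + b * (y i)\<^sup>2 + c * (z i)\<^sup>2 = 0"
    and xy: "i < s" "x i \<noteq> y i" and xz: "j < s" "x j \<noteq> z j"
  shows "a = 0"
proof (rule ccontr)
  assume a: "a \<noteq> 0"
  \<comment> \<open>Applying the polynomial (T - y i)(T - z i) to the relations removes the
    \<open>b\<close> and \<open>c\<close> terms.\<close>
  have "a * ((x i - y i) * (x i - z i)) =
      (a * (x i)\<^sup>2 + b * (y i)\<^sup>2 + c * (z i)\<^sup>2) - (y i + z i) * (a * x i + b * y i + c * z i)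
        + y i * z i * (a + b + c)"
    by (simp add: algebra_simps power2_eq_square)
  then have "a * ((x i - y i) * (x i - z i)) = 0"
    using sum lin[OF xy(1)] quad[OF xy(1)] by simp
  then have "x i = z i"
    using a xy(2) by simp
  moreover have "b * (y i - x i) + c * (z i - x i) = (a * x i + b * y i + c * z i) - x i * (a + b + c)"
    by (simp add: algebra_simps)
  ultimately have "b = 0"
    using sum lin[OF xy(1)] xy(2) by simp
  moreover have "a * (x j - z j) + b * (y j - z j) = (a * x j + b * y j + c * z j) - z j * (a + b + c)"
    by (simp add: algebra_simps)
  ultimately show False
    using sum lin[OF xz(1)] xz(2) a by simp
qed

text \<open>The word \<open>(1, x\<^sub>0, x\<^sub>0\<^sup>2, x\<^sub>1, x\<^sub>1\<^sup>2, \<dots>)\<close>.\<close>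

definition moment_word :: "(nat \<Rightarrow> 'a::field) \<Rightarrow> nat \<Rightarrow> 'a" where
  "moment_word x t = (if t = 0 then 1 else if odd t then x (t div 2) else (x (t div 2 - 1))\<^sup>2)"

lemma moment_word_simps:
  "moment_word x 0 = 1" "moment_word x (2 * i + 1) = x i" "moment_word x (2 * i + 2) = (x i)\<^sup>2"
  by (simp_all add: moment_word_def)

text \<open>Each coefficient is isolated by the two coordinates separating its word from the other
  two, so one elimination serves with the roles permuted.\<close>

lemma moment_words_independent:
  fixes x y z :: "nat \<Rightarrow> 'a::field"
  assumes rel: "\<And>t. t < 2 * s + 1 \<Longrightarrow> a * moment_word x t + b * moment_word y t + c * moment_word z t = 0"
    and "i < s" "x i \<noteq> y i" "j < s" "x j \<noteq> z j" "l < s" "y l \<noteq> z l"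
  shows "a = 0" "b = 0" "c = 0"
proof -
  have sum: "a + b + c = 0"
    using rel[of 0] by (simp add: moment_word_simps)
  have lin: "a * x i + b * y i + c * z i = 0" if "i < s" for i
    using rel[of "2 * i + 1"] that unfolding moment_word_simps by simp
  have quad: "a * (x i)\<^sup>2 + b * (y i)\<^sup>2 + c * (z i)\<^sup>2 = 0" if "i < s" for i
    using rel[of "2 * i + 2"] that unfolding moment_word_simps by simp
  show "a = 0"
    using quadratic_relation_coeff_zero[of a b c s x y z i j] sum lin quad assms(2-) by blast
  show "b = 0"
    by (rule quadratic_relation_coeff_zero[of b a c s y x z i l])
      (use sum lin quad assms(2-) in \<open>simp_all add: add_ac\<close>)
  show "c = 0"
    by (rule quadratic_relation_coeff_zero[of c a b s z x y j l])
      (use sum lin quad assms(2-) in \<open>simp_all add: add_ac\<close>)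
qed

lemma GF2_moment_code:
  assumes k: "0 < k" and n: "k * (2 * s + 1) \<le> n"
  shows "\<exists>C. covering_code2 n k (2 * k) 3 C \<and> card C = 2 ^ (k * s)"
proof -
  let ?K = "GF2 k"
  let ?r = "2 * s + 1"
  obtain \<phi> :: "bit alg_closure \<Rightarrow> nat \<Rightarrow> bit"
    where add: "\<And>x y. \<phi> (x + y) = \<phi> x + \<phi> y" and im: "\<phi> ` ?K = F2n k" and inj: "inj_on \<phi> ?K"
    using GF2_isomorphism[OF k] by blast
  \<comment> \<open>Field elements are laid out as \<open>2 * s + 1\<close> consecutive blocks of
    \<open>k\<close> bits, padded with zeros.\<close>
  define \<Psi> where "\<Psi> g j = (if j < k * ?r then \<phi> (g (j div k)) (j mod k) else 0)" for g j
  define enc where "enc x a = \<Psi> (\<lambda>t. a * moment_word x t)" for x a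
  \<comment> \<open>Extensional functions: words agreeing below \<open>s\<close> are equal, so
    \<open>I\<close> has exactly 2^(k s) elements.\<close>
  define I where "I = {..<s} \<rightarrow>\<^sub>E ?K"
  have \<Psi>_add: "\<Psi> g + \<Psi> h = \<Psi> (\<lambda>t. g t + h t)" for g h
    by (auto simp: \<Psi>_def add fun_eq_iff)
  have \<phi>_0: "\<phi> 0 = 0"
    using add[of 0 0] by simp
  have \<Psi>_F2n: "\<Psi> g \<in> F2n n" for g
    using n by (auto simp: \<Psi>_def F2n_def)
  have \<Psi>_inj: "g t = h t"
    if "\<Psi> g = \<Psi> h" "\<And>t. t < ?r \<Longrightarrow> g t \<in> ?K" "\<And>t. t < ?r \<Longrightarrow> h t \<in> ?K" "t < ?r" for g h t
  proof (rule blockwise_inj[OF im inj that(2,3) _ that(4)])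
    show "\<phi> (g (j div k)) (j mod k) = \<phi> (h (j div k)) (j mod k)" if "j < k * ?r" for j
      using fun_cong[OF \<open>\<Psi> g = \<Psi> h\<close>, of j] that by (simp add: \<Psi>_def)
  qed
  have word: "moment_word x t \<in> ?K" if "x \<in> I" "t < ?r" for x t
  proof -
    have "x i \<in> ?K" if "i < s" for i
      using \<open>x \<in> I\<close> that by (auto simp: I_def)
    then show ?thesis
      using that(2) GF2_closed by (auto simp: moment_word_def power2_eq_square elim!: oddE)
  qed
  have enc_add: "enc x a + enc x b = enc x (a + b)" for x a b
    by (simp add: enc_def \<Psi>_add algebra_simps)
  have enc_0: "enc x 0 = 0" for x
    by (simp add: enc_def \<Psi>_def \<phi>_0 fun_eq_iff)
  have differ: "\<exists>i<s. x i \<noteq> y i" if "x \<in> I" "y \<in> I" "x \<noteq> y" for x y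
    using that PiE_ext[of x "{..<s}" "\<lambda>_. ?K" y] by (auto simp: I_def)
  \<comment> \<open>Position 0 of a moment word is 1 and reveals the scalar; if that is nonzero, the
    odd positions reveal the word.\<close>
  have enc_eq: "a = b \<and> (a = 0 \<or> x = y)" 
    if "enc x a = enc y b" "x \<in> I" "y \<in> I" "a \<in> ?K" "b \<in> ?K" for x y a b
  proof -
    have eq: "a * moment_word x t = b * moment_word y t" if "t < ?r" for t
      using \<Psi>_inj[OF \<open>enc x a = enc y b\<close>[unfolded enc_def] _ _ that] word GF2_closed(4) \<open>x \<in> I\<close> \<open>y \<in> I\<close> \<open>a \<in> ?K\<close> \<open>b \<in> ?K\<close>
      by blast
    have ab: "a = b"
      using eq[of 0] by (simp add: moment_word_simps)
    moreover have "x i = y i" if "i < s" "a \<noteq> 0" for i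
      using eq[of "2 * i + 1"] that ab unfolding moment_word_simps by simp
    ultimately show ?thesis
      using differ that by blast
  qed
  define code where "code x = enc x ` ?K" for x
  have "inj_on code I"
  proof (rule inj_onI)
    fix x y assume xy: "x \<in> I" "y \<in> I" "code x = code y"
    then obtain b where "b \<in> ?K" "enc x 1 = enc y b"
      using GF2_closed(2)[of k] unfolding code_def by blast
    then show "x = y"
      using enc_eq[of x 1 y b] xy GF2_closed(2) by auto
  qed
  then have card: "card (code ` I) = 2 ^ (k * s)"
    by (simp add: card_image I_def card_PiE card_GF2[OF k] power_mult)
  have "code x \<in> Grass2 n k" if "x \<in> I" for x
  proof (rule Grass2I)
    have "enc x a + enc x b \<in> enc x ` ?K" if "a \<in> ?K" "b \<in> ?K" for a b
      using enc_add GF2_closed(3) that by auto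
    moreover have "0 \<in> enc x ` ?K"
      using enc_0 GF2_closed(1) by (metis imageI)
    ultimately show "subspace2 (code x)"
      by (auto simp: code_def subspace2_iff)
    show "code x \<subseteq> F2n n"
      using \<Psi>_F2n by (auto simp: code_def enc_def)
    have "inj_on (enc x) ?K"
      using enc_eq that by (auto simp: inj_on_def)
    then show "card (code x) = 2 ^ k"
      by (simp add: code_def card_image card_GF2[OF k])
  qed
  moreover have "k + 2 * k \<le> dim2 (span2 (\<Union>S))" if S: "S \<subseteq> code ` I" "card S = 3" for S
  proof -
    obtain x y z where xyz: "x \<in> I" "y \<in> I" "z \<in> I" "x \<noteq> y" "x \<noteq> z" "y \<noteq> z"
      "S = {code x, code y, code z}"
      by (rule card_3_obtain_index[OF S])
    \<comment> \<open>Sums of one vector from each line: injectivity yields 2^(3k) vectors in the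
      span.\<close>
    define f where "f = (\<lambda>(a, b, c). enc x a + enc y b + enc z c)"
    have f: "f (a, b, c) = \<Psi> (\<lambda>t. a * moment_word x t + b * moment_word y t + c * moment_word z t)" for a b c
      by (simp add: f_def enc_def \<Psi>_add)
    have "inj_on f (?K \<times> ?K \<times> ?K)"
    proof (rule inj_onI)
      fix u v assume uv: "u \<in> ?K \<times> ?K \<times> ?K" "v \<in> ?K \<times> ?K \<times> ?K" "f u = f v"
      obtain a b c where u: "u = (a, b, c)" by (cases u)
      obtain a' b' c' where v: "v = (a', b', c')" by (cases v)
      have K: "a \<in> ?K" "b \<in> ?K" "c \<in> ?K" "a' \<in> ?K" "b' \<in> ?K" "c' \<in> ?K"
        using uv u v by auto
      have rel: "(a - a') * moment_word x t + (b - b') * moment_word y t + (c - c') * moment_word z t = 0"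
        if "t < ?r" for t
      proof -
        have "a * moment_word x t + b * moment_word y t + c * moment_word z t =
            a' * moment_word x t + b' * moment_word y t + c' * moment_word z t"
          by (rule \<Psi>_inj[OF uv(3)[unfolded u v f] _ _ that])
            (use K xyz(1-3) word in \<open>auto intro!: GF2_closed(3,4)\<close>)
        then show ?thesis
          by (simp add: algebra_simps)
      qed
      obtain i j l where "i < s" "x i \<noteq> y i" "j < s" "x j \<noteq> z j" "l < s" "y l \<noteq> z l"
        using differ xyz by meson
      from moment_words_independent[OF rel this] show "u = v"
        by (simp add: u v)
    qed
    then have "card (f ` (?K \<times> ?K \<times> ?K)) = 2 ^ (k + 2 * k)"
      by (simp add: card_image card_GF2[OF k] card_cartesian_product flip: power_add)
    moreover have "f ` (?K \<times> ?K \<times> ?K) \<subseteq> span2 (\<Union>S)"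
      unfolding span2_def f_def xyz(7)
      by (auto simp: code_def intro!: F2.span_add intro: F2.span_base)
    moreover have "\<Union>S \<subseteq> F2n n"
      using \<Psi>_F2n by (auto simp: xyz(7) code_def enc_def)
    ultimately show ?thesis
      by (intro dim2_span_ge) auto
  qed
  ultimately have "covering_code2 n k (2 * k) 3 (code ` I)"
    by (auto simp: covering_code2_def)
  then show ?thesis
    using card by blast
qed

section \<open>Codes of planes\<close>

lemma bitvec_add_eq_0_iff: "u + v = 0 \<longleftrightarrow> u = v" for u v :: "nat \<Rightarrow> bit"
proof -
  have "- v = v" by (simp only: fun_eq_iff uminus_apply) simp
  then show ?thesis using eq_neg_iff_add_eq_0[of u v] by metis
qed

text \<open>In the binary plane spanned by \<open>u\<close> and \<open>v\<close> exactly one nonzero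
  vector vanishes at the top coordinate \<open>e\<close> of their supports; it becomes
  \<open>u'\<close>.\<close>

lemma echelon_pair:
  assumes "u \<in> F2n d" "u \<noteq> 0" "v \<noteq> 0" "u \<noteq> v" "v \<in> F2n d"
  obtains u' v' e where "u' \<in> {u, v, u + v}" "v' \<in> {u, v, u + v}" "u' \<noteq> 0"
    "v' e = 1" "\<And>i. e < i \<Longrightarrow> v' i = 0" "\<And>i. e \<le> i \<Longrightarrow> u' i = 0"
proof -
  define T where "T = {i. u i \<noteq> 0 \<or> v i \<noteq> 0}"
  have "T \<subseteq> {..<d}"
    using assms(1,5) by (force simp: T_def F2n_def not_less[symmetric])
  then have fin: "finite T" by (rule finite_subset) simp
  have ne: "T \<noteq> {}"
    using assms(2) by (auto simp: T_def fun_eq_iff)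
  define e where "e = Max T"
  have e: "u e \<noteq> 0 \<or> v e \<noteq> 0"
    using Max_in[OF fin ne] by (simp add: e_def T_def)
  have top: "u i = 0" "v i = 0" if "e < i" for i
    using Max_ge[OF fin, of i] that unfolding e_def T_def mem_Collect_eq
    by (metis not_le)+
  have sum: "u + v \<noteq> 0"
    using assms(4) by (simp add: bitvec_add_eq_0_iff)
  consider "v e = 1" "u e = 1" | "v e = 1" "u e = 0" | "v e = 0" "u e = 1"
    using e by (metis bit_not_one_iff)
  then show thesis
  proof cases
    case 1
    then show thesis
      using top sum by (intro that[of "u + v" v e]) (auto simp: le_less)
  next
    case 2
    then show thesis
      using top assms(2) by (intro that[of u v e]) (auto simp: le_less)
  next
    case 3
    then show thesis
      using top assms(3) by (intro that[of v u e]) (auto simp: le_less)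
  qed
qed

text \<open>Multiplication by X^s when \<open>v j\<close> is read as the coefficient of X^j.\<close>

definition shift :: "nat \<Rightarrow> (nat \<Rightarrow> bit) \<Rightarrow> nat \<Rightarrow> bit" where
  "shift s v j = (if j < s then 0 else v (j - s))"

lemma shift_add: "shift s (u + v) = shift s u + shift s v"
  by (auto simp: shift_def fun_eq_iff)

definition unit0 :: "nat \<Rightarrow> bit" where
  "unit0 j = (if j = 0 then 1 else 0)"

text \<open>The five vectors are in echelon form: read the coefficients off the coordinates
  \<open>0\<close>, \<open>1\<close>, \<open>e + 3\<close>, \<open>e + 2\<close> and finally \<open>j + 2\<close> with \<open>w j = 1\<close>.\<close>

lemma inj_echelon5:
  assumes "w \<noteq> 0" "v e = 1" "\<And>i. e < i \<Longrightarrow> v i = 0" "\<And>i. e \<le> i \<Longrightarrow> w i = 0"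
  shows "inj (\<lambda>(a, b, c, d, l). bscale a (unit0 + shift 2 p) + bscale b (shift 1 unit0 + shift 3 p)
    + bscale c (shift 2 w) + bscale d (shift 2 v) + bscale l (shift 3 v))"
    (is "inj ?f")
proof (rule injI)
  fix x y assume eq: "?f x = ?f y"
  obtain a b c d l where x: "x = (a, b, c, d, l)" by (cases x)
  obtain a' b' c' d' l' where y: "y = (a', b', c', d', l')" by (cases y)
  note ev = fun_cong[OF eq[unfolded x y prod.case], simplified plus_fun_apply bscale_def]
  obtain j where j: "w j = 1"
    using assms(1) by (auto simp: fun_eq_iff)
  \<comment> \<open>Settling \<open>a\<close> and \<open>b\<close> first cancels the terms in the
    arbitrary \<open>p\<close> from all later coordinates.\<close>
  have [simp]: "a' = a"
    using ev[of 0] by (simp add: shift_def unit0_def del: add_bit_eq_xor mult_bit_eq_and)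
  have [simp]: "b' = b"
    using ev[of 1] by (simp add: shift_def unit0_def del: add_bit_eq_xor mult_bit_eq_and)
  have [simp]: "l' = l"
    using ev[of "e + 3"] assms(2-) by (simp add: shift_def del: add_bit_eq_xor mult_bit_eq_and)
  have [simp]: "d' = d"
    using ev[of "e + 2"] assms(2-) by (simp add: shift_def del: add_bit_eq_xor mult_bit_eq_and)
  have "c' = c"
    using ev[of "j + 2"] j by (simp add: shift_def del: add_bit_eq_xor mult_bit_eq_and)
  then show "x = y"
    by (simp add: x y)
qed

lemma shift_code:
  assumes n: "d + 3 \<le> n"
  shows "\<exists>C. covering_code2 n 2 3 3 C \<and> card C = 2 ^ d"
proof -
  \<comment> \<open>\<open>g p\<close> is 1 + X^2 p and \<open>h p\<close> is X times it, of degree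
    at most d + 2; hence \<open>d + 3\<close> coordinates.\<close>
  define g where "g p = unit0 + shift 2 p" for p
  define h where "h p = shift 1 unit0 + shift 3 p" for p
  define code where "code p = {0, g p, h p, g p + h p}" for p
  have gh01: "g p 0 = 1" "g p 1 = 0" "h p 0 = 0" "h p 1 = 1" for p
    by (simp_all add: g_def h_def shift_def unit0_def)
  have F2n: "code p \<subseteq> F2n n" if "p \<in> F2n d" for p
    using n that by (auto simp: code_def F2n_def g_def h_def shift_def unit0_def)
  have self: "v + v = 0" "v + (v + w) = w" for v w :: "nat \<Rightarrow> bit"
    by (simp_all add: fun_eq_iff)
  have diff: "g p + g q = shift 2 (p + q)" "h p + h q = shift 3 (p + q)" for p q
    by (simp_all add: g_def h_def fun_eq_iff shift_def)
  have "inj_on code (F2n d)"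
  proof (rule inj_onI)
    fix p q assume "code p = code q"
    then have "g p \<in> code q"
      by (auto simp: code_def)
    \<comment> \<open>Coordinates 0 and 1 tell the vectors of a plane apart: only the
      \<open>g\<close> vector shows 1, 0.\<close>
    moreover have "g p \<noteq> 0" "g p \<noteq> h q" "g p \<noteq> g q + h q"
      using gh01[of p] gh01[of q] by (metis plus_fun_apply zero_fun_apply zero_neq_one add_0)+
    ultimately have "g p = g q"
      by (auto simp: code_def)
    then have "g p (i + 2) = g q (i + 2)" for i
      by simp
    then show "p = q"
      by (simp add: fun_eq_iff g_def shift_def unit0_def del: add_bit_eq_xor mult_bit_eq_and)
  qed
  then have card: "card (code ` F2n d) = 2 ^ d"
    by (simp add: card_image card_F2n)
  have "code p \<in> Grass2 n 2" if "p \<in> F2n d" for p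
  proof (rule Grass2I)
    show "subspace2 (code p)"
      by (auto simp: code_def subspace2_iff self add_ac)
    have "0 \<noteq> g p" "0 \<noteq> h p" "0 \<noteq> g p + h p" "g p \<noteq> h p" "g p \<noteq> g p + h p" "h p \<noteq> g p + h p"
      using gh01[of p] by (auto simp: fun_eq_iff intro: exI[of _ 0] exI[of _ 1])
    then show "card (code p) = 2 ^ 2"
      unfolding code_def by (simp only: card_insert_if finite.intros insert_iff empty_iff) simp
  qed (rule F2n[OF that])
  moreover have "2 + 3 \<le> dim2 (span2 (\<Union>S))" if S: "S \<subseteq> code ` F2n d" "card S = 3" for S
  proof -
    obtain p q r where pqr: "p \<in> F2n d" "q \<in> F2n d" "r \<in> F2n d" "p \<noteq> q" "p \<noteq> r" "q \<noteq> r"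
      "S = {code p, code q, code r}"
      by (rule card_3_obtain_index[OF S])
    \<comment> \<open>Over F_2 these sums are differences, and distinct indices make them nonzero
      and distinct, hence independent.\<close>
    have "p + q \<in> F2n d" "p + q \<noteq> 0" "p + r \<noteq> 0" "p + q \<noteq> p + r" "p + r \<in> F2n d"
      using pqr by (simp_all add: bitvec_add_eq_0_iff) (simp_all add: F2n_def)
    then obtain u v e where uv: "u \<in> {p + q, p + r, (p + q) + (p + r)}"
      "v \<in> {p + q, p + r, (p + q) + (p + r)}" "u \<noteq> 0"
      "v e = 1" "\<And>i. e < i \<Longrightarrow> v i = 0" "\<And>i. e \<le> i \<Longrightarrow> u i = 0"
      by (rule echelon_pair) blast
    \<comment> \<open>The first plane supplies two generators and U + XU three, since X times
      \<open>v\<close> has higher top degree than \<open>u\<close> and \<open>v\<close>.\<close>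
    let ?f = "\<lambda>(a, b, c, x, y). bscale a (g p) + bscale b (h p)
      + bscale c (shift 2 u) + bscale x (shift 2 v) + bscale y (shift 3 v)"
    have "g t \<in> span2 (\<Union>S)" "h t \<in> span2 (\<Union>S)" if "t \<in> {p, q, r}" for t
      using that unfolding span2_def pqr(7) by (auto intro!: F2.span_base simp: code_def)
    then have base: "g p \<in> span2 (\<Union>S)" "h p \<in> span2 (\<Union>S)"
      "shift 2 (p + q) \<in> span2 (\<Union>S)" "shift 2 (p + r) \<in> span2 (\<Union>S)"
      "shift 3 (p + q) \<in> span2 (\<Union>S)" "shift 3 (p + r) \<in> span2 (\<Union>S)"
      unfolding diff[symmetric] span2_def by (auto intro!: F2.span_add)
    have "shift 2 (p + q + (p + r)) \<in> span2 (\<Union>S)" "shift 3 (p + q + (p + r)) \<in> span2 (\<Union>S)"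
      unfolding shift_add[of _ "p + q" "p + r"] span2_def
      by (intro F2.span_add base[unfolded span2_def])+
    with base uv(1,2) have "shift 2 u \<in> span2 (\<Union>S)" "shift 2 v \<in> span2 (\<Union>S)" "shift 3 v \<in> span2 (\<Union>S)"
      by blast+
    then have "range ?f \<subseteq> span2 (\<Union>S)"
      using base(1,2) unfolding span2_def by (auto intro!: F2.span_add F2.span_scale)
    moreover have "card (range ?f) = 2 ^ (2 + 3)"
    proof -
      have UNIV_bit: "(UNIV :: bit set) = {0, 1}"
        by auto
      have "inj ?f"
        unfolding g_def h_def by (rule inj_echelon5[of u v e]) (fact uv)+
      then have "card (range ?f) = card (UNIV :: (bit \<times> bit \<times> bit \<times> bit \<times> bit) set)"
        by (rule card_image)
      also have "\<dots> = 2 ^ (2 + 3)"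
        by (simp only: UNIV_Times_UNIV[symmetric] card_cartesian_product) (simp add: UNIV_bit)
      finally show ?thesis .
    qed
    moreover have "\<Union>S \<subseteq> F2n n"
      unfolding pqr(7) using F2n[OF pqr(1)] F2n[OF pqr(2)] F2n[OF pqr(3)] by simp
    ultimately show ?thesis
      by (intro dim2_span_ge) auto
  qed
  ultimately have "covering_code2 n 2 3 3 (code ` F2n d)"
    by (auto simp: covering_code2_def)
  then show ?thesis
    using card by blast
qed

section \<open>The lower bound\<close>

theorem mainTheorem11:
  fixes n k \<gamma> :: nat
  assumes "0 < n" "0 < k" "0 < \<gamma>"
    and "\<gamma> + 1 \<le> k" "k < 3 * ((\<gamma> + 1) div 2)"
    and "n \<ge> 2 * k + \<gamma>"
  shows "B2 n k (k + \<gamma>) 3 \<ge> 2 ^ (2 * ((n - 2 * k + 1) div (k + 1)))"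
proof -
  define m where "m = (n - 2 * k + 1) div (k + 1)"
  have m: "m * (k + 1) \<le> n - 2 * k + 1"
    unfolding m_def by (rule div_times_less_eq_dividend)
  \<comment> \<open>\<open>\<gamma> = 1\<close> forces k = 2, \<open>\<gamma> = 2\<close> would need
    3 <= k < 3, and larger \<open>\<gamma>\<close> gives k >= 4.\<close>
  consider "k = 2" "\<gamma> = 1" | "4 \<le> k"
    using assms(3-5) by (cases "\<gamma> = 1"; cases "\<gamma> = 2") auto
  then show ?thesis
  proof cases
    case 1
    \<comment> \<open>With k = 2 the quotient bound reads 3 m <= n - 3.\<close>
    have "2 * m + 3 \<le> n"
      using m assms(6) 1 by auto
    then obtain C where "covering_code2 n 2 3 3 C" "card C = 2 ^ (2 * m)"
      using shift_code by blast
    then show ?thesis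
      using B2_ge[of n 2 3 3 C] 1 by (simp add: m_def)
  next
    case 2
    \<comment> \<open>Rounding up keeps 2 s + 1 <= m + 2, while k >= 4 gives k s >= 4 s >= 2
      m.\<close>
    define s where "s = (m + 1) div 2"
    have "k * (2 * s + 1) \<le> n"
    \<comment> \<open>The quotient bound gives k (m + 2) <= n + 1 - m, so m >= 1 absorbs the extra
      1; for m = 0 there is a single block.\<close>
    proof (cases "m = 0")
      case True
      then show ?thesis
        using assms(6) by (simp add: s_def)
    next
      case False
      have "k * (2 * s + 1) \<le> k * (m + 2)"
        by (intro mult_le_mono2) (simp add: s_def)
      also have "\<dots> \<le> n"
        using m assms(6) False by (simp add: algebra_simps)
      finally show ?thesis .
    qed
    then obtain C where C: "covering_code2 n k (2 * k) 3 C" "card C = 2 ^ (k * s)"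
      using GF2_moment_code[OF assms(2)] by blast
    have "covering_code2 n k (k + \<gamma>) 3 C"
      by (rule covering_code2_mono[OF C(1)]) (use assms(4) in simp)
    have "2 * m \<le> k * s"
    proof -
      have "2 * m \<le> 4 * s" by (simp add: s_def)
      also have "\<dots> \<le> k * s" using 2 by (rule mult_le_mono1)
      finally show ?thesis .
    qed
    then have "2 ^ (2 * m) \<le> card C"
      unfolding C(2) by (rule power_increasing) simp
    with \<open>covering_code2 n k (k + \<gamma>) 3 C\<close> show ?thesis
      unfolding m_def[symmetric] by (rule B2_ge)
  qed
qed

end
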